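(* Let $q\ge 0$ and $m\ge1$ be integers, $\Gamma=\{-q,\dots,0,\dots,q\}$ and $N=2q+1$. Let $A\in\mathbb{C}^{m\times N}$ have entries $$A_{l,k}=e^{2\pi \mathrm{i}kt_l},\qquad t_l=\frac{l-1}{m}+\delta_l,\quad l=1,\dots,m,\quad k\in\Gamma,$$ where $0<\delta_l<T$ for all $l$ and $0<T<1/m$ (so that $t_1<\dots<t_m$ and $r=\operatorname{rank}(A)=\min\{m,N\}$). (i) Case $m\ge N$. Assume $T<\min\left\{\frac1m,\frac{1}{(\sqrt2+1)\pi N^{3/2}}\right\}$. Then $$\frac{N}{m\left(1+2\pi N^{3/2}T+\pi^2N^3T^2\right)}\le\sum_{i=1}^{r}\frac{1}{\sigma_i(AA^* )}\le\frac{N}{m\left(1-2\pi N^{3/2}T-\pi^2N^3T^2\right)}.$$ (ii) Case $m<N$. Assume $T<\min\left\{\frac1m,\frac{\sqrt{2N}-\sqrt{N+m}}{\pi\sqrt m\,N^{3/2}}\right\}$. Then $$\frac{1}{\lceil N/m\rceil+2\pi\sqrt{\lceil N/m\rceil}\,N^{3/2}T+\pi^2N^3T^2}\le\sum_{i=1}^{r}\frac{1}{\sigma_i(AA^* )}\le\frac{1}{\lfloor N/m\rfloor-2\pi\sqrt{\lceil N/m\rceil}\,N^{3/2}T-\pi^2N^3T^2}.$$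
   Context: $A^*$ denotes the conjugate transpose. The nonzero singular values of $AA^*$, counted with multiplicity, are listed in decreasing order $\sigma_1(AA^* )\ge\dots\ge\sigma_r(AA^* )>0$. *)

theory Defs
  imports
    Complex_Main
    "HOL-Library.Multiset"
    "HOL-Computational_Algebra.Polynomial"
    "Jordan_Normal_Form.Char_Poly"
    "Jordan_Normal_Form.Schur_Decomposition"
    "Jordan_Normal_Form.DL_Rank"
begin

(* The eigenvalues of M* M are real and nonnegative, so taking their real part loses nothing.
   Algebraic multiplicities are retained; there are dim_col M entries. *)
definition singular_values_mset :: "complex mat \<Rightarrow> real multiset" where
  "singular_values_mset M =
     image_mset (\<lambda>\<mu>. sqrt (Re \<mu>)) (proots (char_poly (mat_adjoint M * M)))"

definition nonzero_singular_values :: "complex mat \<Rightarrow> real list" where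
  "nonzero_singular_values M =
     rev (sorted_list_of_multiset (filter_mset (\<lambda>s. s \<noteq> 0) (singular_values_mset M)))"

(* sigma_i, with i starting at 1; meaningful for i up to the length of the list. *)
definition nonzero_singular_value :: "nat \<Rightarrow> complex mat \<Rightarrow> real" where
  "nonzero_singular_value i M = nonzero_singular_values M ! (i - 1)"

(* t_l, where l ranges over 1..m; only the values of d on 1..m are used. *)
definition sample_point :: "nat \<Rightarrow> (nat \<Rightarrow> real) \<Rightarrow> nat \<Rightarrow> real" where
  "sample_point m d l = (real l - 1) / real m + d l"

(* Matrix indices start at 0: row i carries l = i + 1, and column j carries the frequency
   k = j - q, which runs through -q, ..., q. *)
definition sampling_matrix :: "nat \<Rightarrow> nat \<Rightarrow> (nat \<Rightarrow> real) \<Rightarrow> complex mat" where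
  "sampling_matrix q m d = mat m (2 * q + 1) (\<lambda>(i, j).
     exp (2 * of_real pi * \<i> * of_int (int j - int q) * of_real (sample_point m d (i + 1))))"

end

theory Submission
  imports Defs "HOL-Analysis.L2_Norm"
begin

text \<open>
  The nonzero eigenvalues of \<open>A A\<^sup>*\<close> are those of the smaller Gram matrix \<open>M\<^sup>* M\<close>, where
  \<open>M = A\<close> for \<open>m \<ge> N\<close> and \<open>M = A\<^sup>*\<close> for \<open>m < N\<close>, so each of them is a quotient
  \<open>\<parallel>M x\<parallel>\<^sup>2 / \<parallel>x\<parallel>\<^sup>2\<close>. For equispaced points \<open>(l - 1) / m\<close> Parseval's identity on \<open>m\<close> consecutive
  frequencies places this quotient between \<open>m f\<close> and \<open>m c\<close>, where \<open>f = c = 1\<close> in the first case and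
  \<open>f = \<lfloor>N / m\<rfloor>\<close>, \<open>c = \<lceil>N / m\<rceil>\<close> in the second. Moving the points by less than \<open>T\<close> changes every
  entry by at most \<open>\<pi> N T\<close>, hence \<open>M\<close> by at most \<open>\<surd>m \<epsilon>\<close> in Frobenius norm, where
  \<open>\<epsilon> = \<pi> N\<^bsup>3/2\<^esup> T\<close>. All nonzero eigenvalues therefore lie between \<open>m (f - 2 \<surd>c \<epsilon> - \<epsilon>\<^sup>2)\<close> and
  \<open>m (c + 2 \<surd>c \<epsilon> + \<epsilon>\<^sup>2)\<close>; the hypothesis on \<open>T\<close> makes the lower bound positive, and a
  Vandermonde argument shows that there are exactly \<open>min m N\<close> of them.
\<close>

section \<open>Spectra of Gram matrices\<close>

lemma mat_adjoint_carrier [simp]: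
  "A \<in> carrier_mat p n \<Longrightarrow> mat_adjoint A \<in> carrier_mat n p"
  unfolding mat_adjoint_def by (auto simp: mat_of_rows_def)

lemma dim_mat_adjoint [simp]:
  "dim_row (mat_adjoint A) = dim_col A" "dim_col (mat_adjoint A) = dim_row A"
  using carrier_matD[OF mat_adjoint_carrier[of A "dim_row A" "dim_col A"]] by auto

lemma mat_adjoint_index [simp]:
  assumes "A \<in> carrier_mat p n" "i < n" "j < p"
  shows "mat_adjoint A $$ (i, j) = conjugate (A $$ (j, i))"
  using assms unfolding mat_adjoint_def by (auto simp: mat_of_rows_def)

lemma mat_adjoint_mat_adjoint [simp]:
  fixes A :: "complex mat"
  shows "mat_adjoint (mat_adjoint A) = A"
proof -
  have A: "A \<in> carrier_mat (dim_row A) (dim_col A)" by auto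
  note A' = mat_adjoint_carrier[OF A]
  show ?thesis
  proof (rule eq_matI)
    fix i j assume ij: "i < dim_row A" "j < dim_col A"
    show "mat_adjoint (mat_adjoint A) $$ (i, j) = A $$ (i, j)"
      unfolding mat_adjoint_index[OF A' ij] mat_adjoint_index[OF A ij(2) ij(1)] by simp
  qed auto
qed

lemma mat_adjoint_mult_self:
  fixes M :: "complex mat"
  assumes M: "M \<in> carrier_mat p n"
  shows "mat_adjoint (mat_adjoint M * M) = mat_adjoint M * M"
proof -
  have G: "mat_adjoint M * M \<in> carrier_mat n n" using M by (auto intro: mult_carrier_mat[of _ _ p])
  have ent: "(mat_adjoint M * M) $$ (i, j) = (\<Sum>k<p. cnj (M $$ (k, i)) * M $$ (k, j))"
    if "i < n" "j < n" for i j
    using that M mat_adjoint_carrier[OF M]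
    by (simp add: scalar_prod_def lessThan_atLeast0)
  show ?thesis
  proof (rule eq_matI)
    fix i j assume "i < dim_row (mat_adjoint M * M)" "j < dim_col (mat_adjoint M * M)"
    then have ij: "i < n" "j < n" using M by auto
    then show "mat_adjoint (mat_adjoint M * M) $$ (i, j) = (mat_adjoint M * M) $$ (i, j)"
      unfolding mat_adjoint_index[OF G ij] ent[OF ij] ent[OF ij(2) ij(1)] by (simp add: mult.commute)
  qed (use M in auto)
qed

lemma nonzero_vec_index:
  assumes "x \<in> carrier_vec n" "x \<noteq> 0\<^sub>v n"
  shows "\<exists>j<n. x $ j \<noteq> 0"
proof (rule ccontr)
  assume "\<not> ?thesis"
  then have "x = 0\<^sub>v n"
    using assms(1) by (intro eq_vecI) auto
  with assms(2) show False by contradiction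
qed

lemma sum_cmod_square_pos:
  fixes g :: "nat \<Rightarrow> complex"
  assumes "\<exists>j<n. g j \<noteq> 0"
  shows "0 < (\<Sum>j<n. (cmod (g j))\<^sup>2)"
proof -
  from assms obtain j where "j < n" "g j \<noteq> 0" by blast
  then show ?thesis
    by (intro sum_pos2[of "{..<n}" j]) auto
qed

section \<open>Eigenvalues of Gram matrices as quotients of squared norms\<close>

text \<open>Pairing the eigenvector equation with \<open>x\<close> turns it into z |x|^2 = |M x|^2.
  The identity is kept over the complex numbers, so that its real part yields bounds and its
  imaginary part yields realness of \<open>z\<close>.\<close>

lemma gram_eigenvalue:
  fixes M :: "complex mat"
  assumes M: "M \<in> carrier_mat p n"
    and root: "poly (char_poly (mat_adjoint M * M)) z = 0"
  obtains x where "x \<in> carrier_vec n" "x \<noteq> 0\<^sub>v n"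
    "z * of_real (\<Sum>j<n. (cmod (x $ j))\<^sup>2)
      = of_real (\<Sum>i<p. (cmod (\<Sum>j<n. M $$ (i, j) * x $ j))\<^sup>2)"
proof -
  note M' = mat_adjoint_carrier[OF M]
  have G: "mat_adjoint M * M \<in> carrier_mat n n" using M by (auto intro: mult_carrier_mat[of _ _ p])
  from root obtain x where "eigenvector (mat_adjoint M * M) x z"
    by (auto simp: eigenvalue_root_char_poly[OF G, symmetric] eigenvalue_def)
  then have x: "x \<in> carrier_vec n" "x \<noteq> 0\<^sub>v n" and ev: "(mat_adjoint M * M) *\<^sub>v x = z \<cdot>\<^sub>v x"
    using G by (auto simp: eigenvector_def)
  define y where "y i = (\<Sum>j<n. M $$ (i, j) * x $ j)" for i
  have Mx: "(M *\<^sub>v x) $ i = y i" if "i < p" for i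
    using that M x by (simp add: y_def scalar_prod_def lessThan_atLeast0)
  have "mat_adjoint M *\<^sub>v (M *\<^sub>v x) = z \<cdot>\<^sub>v x"
    using ev by (simp add: assoc_mult_mat_vec[OF M' M x(1)])
  then have "z * x $ j = (mat_adjoint M *\<^sub>v (M *\<^sub>v x)) $ j" if "j < n" for j
    using that x by simp
  also have "(mat_adjoint M *\<^sub>v (M *\<^sub>v x)) $ j = (\<Sum>i<p. cnj (M $$ (i, j)) * y i)" if "j < n" for j
  proof -
    have "(mat_adjoint M *\<^sub>v (M *\<^sub>v x)) $ j = (\<Sum>i<p. mat_adjoint M $$ (j, i) * (M *\<^sub>v x) $ i)"
      using that M carrier_matD[OF M'] by (simp add: scalar_prod_def lessThan_atLeast0)
    then show ?thesis by (simp add: mat_adjoint_index[OF M that] Mx)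
  qed
  finally have zx: "z * x $ j = (\<Sum>i<p. cnj (M $$ (i, j)) * y i)" if "j < n" for j
    using that by blast
  \<comment> \<open>Multiply \<open>zx\<close> by the conjugate of \<open>x $ j\<close> and sum over
    \<open>j\<close>; after exchanging the sums, the inner one is the conjugate of
    \<open>y i\<close>.\<close>
  have "z * of_real (\<Sum>j<n. (cmod (x $ j))\<^sup>2) = (\<Sum>j<n. cnj (x $ j) * (z * x $ j))"
    by (simp add: complex_norm_square sum_distrib_left mult_ac del: of_real_power)
  also have "\<dots> = (\<Sum>j<n. \<Sum>i<p. cnj (x $ j) * cnj (M $$ (i, j)) * y i)"
    by (simp add: zx sum_distrib_left mult_ac)
  also have "\<dots> = (\<Sum>i<p. \<Sum>j<n. cnj (x $ j) * cnj (M $$ (i, j)) * y i)"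
    by (rule sum.swap)
  also have "\<dots> = (\<Sum>i<p. cnj (y i) * y i)"
  proof (intro sum.cong refl)
    fix i
    have "cnj (y i) = (\<Sum>j<n. cnj (x $ j) * cnj (M $$ (i, j)))"
      by (simp add: y_def mult.commute)
    then show "(\<Sum>j<n. cnj (x $ j) * cnj (M $$ (i, j)) * y i) = cnj (y i) * y i"
      by (simp only: sum_distrib_right)
  qed
  also have "\<dots> = of_real (\<Sum>i<p. (cmod (y i))\<^sup>2)"
    by (simp add: complex_norm_square mult_ac del: of_real_power)
  finally show ?thesis
    using that[OF x] by (simp add: y_def)
qed

text \<open>Frame bounds of \<open>M\<close> enclose every quotient |M x|^2 / |x|^2, hence every
  eigenvalue. They are stated for functions instead of vectors, the form in which the Fourier
  estimates below deliver them.\<close>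

lemma gram_eigenvalue_bounds:
  fixes M :: "complex mat"
  assumes M: "M \<in> carrier_mat p n"
    and root: "poly (char_poly (mat_adjoint M * M)) z = 0"
    and lo: "\<And>x. L * (\<Sum>j<n. (cmod (x j))\<^sup>2) \<le> (\<Sum>i<p. (cmod (\<Sum>j<n. M $$ (i, j) * x j))\<^sup>2)"
    and hi: "\<And>x. (\<Sum>i<p. (cmod (\<Sum>j<n. M $$ (i, j) * x j))\<^sup>2) \<le> U * (\<Sum>j<n. (cmod (x j))\<^sup>2)"
  shows "L \<le> Re z" and "Re z \<le> U"
proof -
  from gram_eigenvalue[OF M root] obtain x where x: "x \<in> carrier_vec n" "x \<noteq> 0\<^sub>v n"
    and eq: "z * of_real (\<Sum>j<n. (cmod (x $ j))\<^sup>2)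
      = of_real (\<Sum>i<p. (cmod (\<Sum>j<n. M $$ (i, j) * x $ j))\<^sup>2)" .
  define X where "X = (\<Sum>j<n. (cmod (x $ j))\<^sup>2)"
  have X: "0 < X"
    unfolding X_def by (rule sum_cmod_square_pos) (rule nonzero_vec_index[OF x])
  define Y where "Y = (\<Sum>i<p. (cmod (\<Sum>j<n. M $$ (i, j) * x $ j))\<^sup>2)"
  have "z * of_real X = of_real Y"
    using eq by (simp only: X_def Y_def)
  then have "Re (z * of_real X) = Re (of_real Y)" by (rule arg_cong)
  then have "Re z * X = Y" by simp
  then have "L * X \<le> Re z * X" "Re z * X \<le> U * X"
    using lo[of "\<lambda>j. x $ j"] hi[of "\<lambda>j. x $ j"] by (simp_all only: X_def Y_def)
  with X show "L \<le> Re z" and "Re z \<le> U" by (simp_all only: mult_le_cancel_right_pos)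
qed

text \<open>Injectivity makes |M x|^2 strictly positive for an eigenvector \<open>x\<close>, so zero
  is not an eigenvalue of the Gram matrix.\<close>

lemma gram_eigenvalue_pos:
  fixes M :: "complex mat"
  assumes M: "M \<in> carrier_mat p n"
    and root: "poly (char_poly (mat_adjoint M * M)) z = 0"
    and inj: "\<And>x. x \<in> carrier_vec n \<Longrightarrow> M *\<^sub>v x = 0\<^sub>v p \<Longrightarrow> x = 0\<^sub>v n"
  shows "0 < Re z" and "Im z = 0"
proof -
  from gram_eigenvalue[OF M root] obtain x where x: "x \<in> carrier_vec n" "x \<noteq> 0\<^sub>v n"
    and eq: "z * of_real (\<Sum>j<n. (cmod (x $ j))\<^sup>2)
      = of_real (\<Sum>i<p. (cmod (\<Sum>j<n. M $$ (i, j) * x $ j))\<^sup>2)" .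
  define X where "X = (\<Sum>j<n. (cmod (x $ j))\<^sup>2)"
  have X: "0 < X"
    unfolding X_def by (rule sum_cmod_square_pos) (rule nonzero_vec_index[OF x])
  define Y where "Y = (\<Sum>i<p. (cmod (\<Sum>j<n. M $$ (i, j) * x $ j))\<^sup>2)"
  have Mx: "(M *\<^sub>v x) $ i = (\<Sum>j<n. M $$ (i, j) * x $ j)" if "i < p" for i
    using that M x by (simp add: scalar_prod_def lessThan_atLeast0)
  have "M *\<^sub>v x \<noteq> 0\<^sub>v p" using inj x by blast
  then have "\<exists>i<p. (M *\<^sub>v x) $ i \<noteq> 0"
    using nonzero_vec_index mult_mat_vec_carrier[OF M x(1)] by blast
  then have Y: "0 < Y"
    unfolding Y_def by (intro sum_cmod_square_pos) (auto simp: Mx)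
  have "z * of_real X = of_real Y"
    using eq by (simp only: X_def Y_def)
  then have "Re (z * of_real X) = Re (of_real Y)" "Im (z * of_real X) = Im (of_real Y)"
    by (rule arg_cong)+
  then have "Re z * X = Y" "Im z * X = 0" by simp_all
  then show "0 < Re z" "Im z = 0"
    using X Y by (auto simp: zero_less_mult_iff)
qed

section \<open>Nonzero singular values of a Hermitian matrix\<close>

lemma proots_linear_factors:
  "proots (\<Prod>a\<leftarrow>as. [:- a, 1:]) = mset (as :: 'a :: idom list)"
  proof (induction as)
  case (Cons a as)
  have "(\<Prod>b\<leftarrow>as. [:- b, 1:]) \<noteq> 0"
    by (auto simp: prod_list_zero_iff)
  with Cons show ?case by (simp add: proots_mult del: mult_pCons_left)
qed simp

text \<open>Schur decomposition: \<open>H\<close> is similar to an upper triangular \<open>B\<close>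
  with the eigenvalues on the diagonal, and the diagonal of \<open>B * B\<close> consists of their
  squares. This keeps algebraic multiplicities, which an argument with single eigenvectors would
  lose.\<close>

lemma proots_char_poly_square:
  fixes H :: "complex mat"
  assumes H: "H \<in> carrier_mat d d"
  shows "proots (char_poly (H * H)) = image_mset (\<lambda>z. z\<^sup>2) (proots (char_poly H))"
proof -
  from char_poly_factorized[OF H] obtain es where es: "char_poly H = (\<Prod>a\<leftarrow>es. [:- a, 1:])"
    by blast
  obtain B P Q where "schur_decomposition H es = (B, P, Q)" by (cases "schur_decomposition H es")
  from schur_decomposition[OF H es this]
  have wit: "similar_mat_wit H B P Q" and ut: "upper_triangular B" and diag: "diag_mat B = es"
    by auto
  from similar_mat_witD2[OF H wit]
  have B: "B \<in> carrier_mat d d" and BB: "B * B \<in> carrier_mat d d" by auto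
  have "similar_mat_wit (H ^\<^sub>m 2) (B ^\<^sub>m 2) P Q"
    by (rule similar_mat_wit_pow[OF wit])
  then have "similar_mat (H * H) (B * B)"
    using H B by (auto simp: similar_mat_def numeral_2_eq_2)
  then have "char_poly (H * H) = char_poly (B * B)"
    by (rule char_poly_similar)
  also have ent: "(B * B) $$ (i, j) = (\<Sum>k<d. B $$ (i, k) * B $$ (k, j))" if "i < d" "j < d" for i j
    using that B by (simp add: scalar_prod_def lessThan_atLeast0)
  have zero: "B $$ (i, j) = 0" if "j < i" "i < d" for i j
    using ut B that by auto
  have "upper_triangular (B * B)"
  proof (rule upper_triangularI)
    fix i j assume "j < i" "i < dim_row (B * B)"
    then have ij: "j < i" "i < d" using B by auto
    \<comment> \<open>As \<open>j < i\<close>, every \<open>k\<close> satisfies \<open>k < i\<close>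
      or \<open>j < k\<close>, so one of the two factors lies below the diagonal.\<close>
    then have "\<forall>k<d. B $$ (i, k) * B $$ (k, j) = 0"
      by (metis zero mult_eq_0_iff not_less order_le_less_trans)
    then show "(B * B) $$ (i, j) = 0" using ij by (simp only: ent) (auto intro!: sum.neutral)
  qed
  then have "char_poly (B * B) = (\<Prod>a\<leftarrow>diag_mat (B * B). [:- a, 1:])"
    by (rule char_poly_upper_triangular[OF BB])
  also have "diag_mat (B * B) = map (\<lambda>z. z\<^sup>2) (diag_mat B)"
  proof -
    have "(B * B) $$ (i, i) = (B $$ (i, i))\<^sup>2" if i: "i < d" for i
    proof -
      have "B $$ (i, k) * B $$ (k, i) = 0" if "k < d" "k \<noteq> i" for k
        using that i by (cases "k < i") (auto simp: zero)
      then have "(\<Sum>k<d. B $$ (i, k) * B $$ (k, i)) = (\<Sum>k<d. if k = i then (B $$ (i, i))\<^sup>2 else 0)"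
        by (intro sum.cong refl) (auto simp: power2_eq_square)
      with i show ?thesis by (simp add: ent)
    qed
    with B show ?thesis by (simp add: diag_mat_def)
  qed
  finally have "char_poly (H * H) = (\<Prod>a\<leftarrow>map (\<lambda>z. z\<^sup>2) es. [:- a, 1:])"
    by (simp only: diag)
  then show ?thesis
    unfolding es by (simp only: proots_linear_factors mset_map)
qed

text \<open>For Hermitian \<open>H\<close> the matrix in the definition of singular values is
  \<open>H * H\<close>, and the square root of the square of a positive eigenvalue is that
  eigenvalue. So the singular values of A A* are its eigenvalues, not their square roots.\<close>

lemma nonzero_singular_values_eq:
  fixes H :: "complex mat"
  assumes H: "H \<in> carrier_mat d d" and herm: "mat_adjoint H = H"
    and spec: "proots (char_poly H) = replicate_mset k 0 + \<Lambda>"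
    and pos: "\<And>z. z \<in># \<Lambda> \<Longrightarrow> Im z = 0 \<and> 0 < Re z"
  shows "nonzero_singular_values H = rev (sorted_list_of_multiset (image_mset Re \<Lambda>))"
proof -
  have "sqrt (Re (z\<^sup>2)) = Re z" if "z \<in># \<Lambda>" for z
    using pos[OF that] by (simp add: power2_eq_square)
  then have img: "image_mset (\<lambda>z. sqrt (Re (z\<^sup>2))) \<Lambda> = image_mset Re \<Lambda>"
    by (intro image_mset_cong) auto
  have pp[unfolded spec]: "proots (char_poly (H * H)) = image_mset (\<lambda>z. z\<^sup>2) (proots (char_poly H))" using H proots_char_poly_square by blast
  have "singular_values_mset H = replicate_mset k 0 + image_mset Re \<Lambda>"
    unfolding singular_values_mset_def herm pp
    by (simp add: multiset.map_comp o_def img)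
  moreover have "filter_mset (\<lambda>s. s \<noteq> 0) (replicate_mset k (0::real)) = {#}"
    by (induction k) auto
  moreover have "filter_mset (\<lambda>s. s \<noteq> 0) (image_mset Re \<Lambda>) = image_mset Re \<Lambda>"
    by (rule filter_mset_eq_conv[THEN iffD2]) (use pos in force)
  ultimately show ?thesis
    by (simp only: nonzero_singular_values_def filter_union_mset add_0)
qed

text \<open>Meant for \<open>H\<close> = A A* and for \<open>M\<close> equal to A or to its adjoint,
  whichever is injective; \<open>k\<close> accounts for the difference in size. All \<open>n\<close>
  eigenvalues of the Gram matrix are positive, so the filter for nonzero values keeps exactly
  these.\<close>

lemma nonzero_singular_values_gram:
  fixes M H :: "complex mat"
  assumes H: "H \<in> carrier_mat d d" and herm: "mat_adjoint H = H"
    and M: "M \<in> carrier_mat p n"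
    and spec: "proots (char_poly H) = replicate_mset k 0 + proots (char_poly (mat_adjoint M * M))"
    and inj: "\<And>x. x \<in> carrier_vec n \<Longrightarrow> M *\<^sub>v x = 0\<^sub>v p \<Longrightarrow> x = 0\<^sub>v n"
  shows "length (nonzero_singular_values H) = n"
    and "\<And>s. s \<in> set (nonzero_singular_values H) \<Longrightarrow>
      0 < s \<and> poly (char_poly (mat_adjoint M * M)) (complex_of_real s) = 0"
proof -
  define \<Lambda> where "\<Lambda> = proots (char_poly (mat_adjoint M * M))"
  have G: "mat_adjoint M * M \<in> carrier_mat n n" using M by (auto intro: mult_carrier_mat[of _ _ p])
  define P where "P = char_poly (mat_adjoint M * M)"
  have P: "degree P = n" "coeff P n = 1"
    using degree_monic_char_poly[OF G] by (simp_all add: P_def)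
  then have "P \<noteq> 0" by auto
  then have root: "poly P z = 0" if "z \<in># \<Lambda>" for z
    using that by (simp add: \<Lambda>_def P_def[symmetric])
  have pos: "Im z = 0 \<and> 0 < Re z" if "z \<in># \<Lambda>" for z
    using gram_eigenvalue_pos[OF M root[OF that, unfolded P_def] inj] by blast
  have eq: "nonzero_singular_values H = rev (sorted_list_of_multiset (image_mset Re \<Lambda>))"
    by (rule nonzero_singular_values_eq[OF H herm spec[folded \<Lambda>_def] pos])
  have "mset (nonzero_singular_values H) = image_mset Re \<Lambda>"
    by (simp only: eq mset_rev mset_sorted_list_of_multiset)
  moreover have "size \<Lambda> = n"
    unfolding \<Lambda>_def P_def[symmetric] by (simp add: size_proots_complex P)
  ultimately show "length (nonzero_singular_values H) = n"
    by (metis size_mset size_image_mset)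
  fix s assume "s \<in> set (nonzero_singular_values H)"
  then obtain z where z: "z \<in># \<Lambda>" and s: "s = Re z"
    unfolding eq by auto
  \<comment> \<open>Since \<open>z\<close> is real, passing to its real part and back recovers the
    root.\<close>
  have "complex_of_real s = z"
    using pos[OF z] by (simp add: s complex_eq_iff)
  then show "0 < s \<and> poly (char_poly (mat_adjoint M * M)) (complex_of_real s) = 0"
    using pos[OF z] root[OF z] unfolding P_def s by metis
qed

section \<open>Comparing the spectra of \<open>A * B\<close> and \<open>B * A\<close>\<close>

text \<open>Sylvester's identity by block determinants. The block matrix \<open>K\<close> has
  determinant \<open>char_poly (A * B)\<close>, because \<open>P\<close> has determinant 1;
  multiplying by \<open>Q\<close>, of determinant X^n, gives X^p times
  \<open>char_poly (B * A)\<close>.\<close>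

lemma char_poly_mult_commute:
  fixes A :: "'a :: field mat"
  assumes A: "A \<in> carrier_mat p n" and B: "B \<in> carrier_mat n p"
  shows "[:0, 1:] ^ n * char_poly (A * B) = [:0, 1:] ^ p * char_poly (B * A)"
proof -
  define X :: "'a poly" where "X = [:0, 1:]"
  define h :: "'a mat \<Rightarrow> 'a poly mat" where "h = map_mat (\<lambda>a. [:a:])"
  interpret h: comm_ring_hom "\<lambda>a :: 'a. [:a:]" by unfold_locales auto
  have hA: "h A \<in> carrier_mat p n" and hB: "h B \<in> carrier_mat n p"
    using A B by (auto simp: h_def)
  have hAB: "h (A * B) = h A * h B" and hBA: "h (B * A) = h B * h A"
    unfolding h_def using A B by (auto intro!: h.mat_hom_mult)
  have cp: "char_poly C = det (X \<cdot>\<^sub>m 1\<^sub>m k - h C)" if "C \<in> carrier_mat k k" for C k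
    unfolding char_poly_def char_poly_matrix_def
    by (rule arg_cong[of _ _ det]) (use that in \<open>auto simp: X_def h_def intro!: eq_matI\<close>)
  define K where "K = four_block_mat (X \<cdot>\<^sub>m 1\<^sub>m p) (h A) (h B) (1\<^sub>m n)"
  define P where "P = four_block_mat (1\<^sub>m p) (0\<^sub>m p n) (- h B) (1\<^sub>m n)"
  define Q where "Q = four_block_mat (1\<^sub>m p) (0\<^sub>m p n) (- h B) (X \<cdot>\<^sub>m 1\<^sub>m n)"
  have car: "K \<in> carrier_mat (p + n) (p + n)" "P \<in> carrier_mat (p + n) (p + n)"
    "Q \<in> carrier_mat (p + n) (p + n)"
    unfolding K_def P_def Q_def using hA hB by auto
  have BB: "h B + - h B = 0\<^sub>m n p" "- (h B * (X \<cdot>\<^sub>m 1\<^sub>m p)) + X \<cdot>\<^sub>m 1\<^sub>m n * h B = 0\<^sub>m n p"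
    using hB by (auto intro!: eq_matI
        simp: mult_smult_distrib[OF hB one_carrier_mat] mult_smult_assoc_mat[OF one_carrier_mat hB])
  have sub: "X \<cdot>\<^sub>m 1\<^sub>m p + - (h A * h B) = X \<cdot>\<^sub>m 1\<^sub>m p - h A * h B"
    "- (h B * h A) + X \<cdot>\<^sub>m 1\<^sub>m n = X \<cdot>\<^sub>m 1\<^sub>m n - h B * h A"
    using hA hB by (auto intro!: eq_matI)
  \<comment> \<open>\<open>K\<close> is reduced to block triangular form from either side.\<close>
  have KP: "K * P = four_block_mat (X \<cdot>\<^sub>m 1\<^sub>m p - h A * h B) (h A) (0\<^sub>m n p) (1\<^sub>m n)"
    unfolding K_def P_def
    by (subst mult_four_block_mat[of _ p p _ n _ n _ _ p _ n])
      (use hA hB in \<open>simp_all add: BB sub del: four_block_one_mat\<close>)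
  have QK: "Q * K = four_block_mat (X \<cdot>\<^sub>m 1\<^sub>m p) (h A) (0\<^sub>m n p) (X \<cdot>\<^sub>m 1\<^sub>m n - h B * h A)"
    unfolding K_def Q_def
    by (subst mult_four_block_mat[of _ p p _ n _ n _ _ p _ n])
      (use hA hB in \<open>simp_all add: BB sub del: four_block_one_mat\<close>)
  have "det (K * P) = char_poly (A * B)"
    unfolding KP using A B hA hB
    by (subst det_four_block_mat_lower_left_zero[of _ p _ n]) (auto simp: cp[of "A * B" p] hAB)
  moreover have "det P = 1"
    unfolding P_def using hB
    by (subst det_four_block_mat_upper_right_zero[of _ p _ n]) auto
  ultimately have "det K = char_poly (A * B)"
    using car by (simp add: det_mult)
  moreover have "det Q = X ^ n"
    unfolding Q_def using hB
    by (subst det_four_block_mat_upper_right_zero[of _ p _ n]) (auto simp: det_smult)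
  moreover have "det (Q * K) = X ^ p * char_poly (B * A)"
    unfolding QK using A B hA hB
    by (subst det_four_block_mat_lower_left_zero[of _ p _ n]) (auto simp: cp[of "B * A" n] hBA det_smult)
  ultimately show ?thesis
    using car by (simp add: det_mult X_def)
qed

text \<open>Compare the roots on both sides of the preceding identity and cancel \<open>n\<close>
  common zeros.\<close>

lemma proots_char_poly_mult_commute:
  fixes A B :: "complex mat"
  assumes A: "A \<in> carrier_mat p n" and B: "B \<in> carrier_mat n p" and le: "n \<le> p"
  shows "proots (char_poly (A * B)) = replicate_mset (p - n) 0 + proots (char_poly (B * A))"
proof -
  have AB: "A * B \<in> carrier_mat p p" and BA: "B * A \<in> carrier_mat n n"
    using A B by auto
  have nz: "char_poly (A * B) \<noteq> 0" "char_poly (B * A) \<noteq> 0"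
    using degree_monic_char_poly[OF AB] degree_monic_char_poly[OF BA] by auto
  have X: "proots ([:0, 1:] ^ k :: complex poly) = replicate_mset k 0" for k
    by (simp add: proots_power)
  have "replicate_mset n 0 + proots (char_poly (A * B)) = replicate_mset p 0 + proots (char_poly (B * A))"
    using arg_cong[OF char_poly_mult_commute[OF A B], of proots] nz
    by (simp add: proots_mult X del: mult_pCons_left)
  moreover have "replicate_mset p (0::complex) = replicate_mset n 0 + replicate_mset (p - n) 0"
    using le by (simp add: multiset_eq_iff)
  ultimately show ?thesis by (simp add: add.assoc)
qed

section \<open>Discrete Fourier transform and perturbation of frame bounds\<close>

text \<open>A geometric series with ratio \<open>w\<close>, an m-th root of unity. The bound on
  \<open>k\<close> ensures that \<open>w = 1\<close> only for \<open>k = 0\<close>, since otherwise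
  \<open>m\<close> would divide a nonzero integer of smaller modulus.\<close>

lemma sum_cis_roots_of_unity:
  fixes m :: nat and k :: int
  assumes "m \<ge> 1" and "\<bar>k\<bar> < int m"
  shows "(\<Sum>j<m. cis (2 * pi * real j * real_of_int k / real m)) = (if k = 0 then of_nat m else 0)"
proof (cases "k = 0")
  case False
  define w where "w = cis (2 * pi * real_of_int k / real m)"
  have pow: "w ^ j = cis (2 * pi * real j * real_of_int k / real m)" for j
    by (simp add: w_def Complex.DeMoivre mult_ac)
  have "2 * pi * real m * real_of_int k / real m = 2 * pi * real_of_int k"
    using assms(1) by simp
  then have wm: "w ^ m = 1"
    by (simp only: pow) (rule cis_multiple_2pi, simp)
  have "w \<noteq> 1"
  proof
    assume "w = 1"
    then have "cos (2 * pi * real_of_int k / real m) = 1"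
      by (simp add: w_def complex_eq_iff)
    then obtain n :: int where "2 * pi * real_of_int k / real m = real_of_int n * 2 * pi"
      using cos_one_2pi_int by blast
    then have "real_of_int k = real_of_int (n * int m)"
      using assms(1) by (simp add: field_simps)
    then have "k = n * int m"
      using of_int_eq_iff by blast
    with assms(2) False show False
      by (metis abs_mult abs_of_nat dvd_imp_le_int dvd_triv_right not_le)
  qed
  then have "(\<Sum>j<m. w ^ j) = 0"
    by (simp add: geometric_sum wm)
  with False show ?thesis by (simp add: pow)
qed simp

text \<open>Orthogonality of the characters. The starting frequency \<open>a\<close> is arbitrary:
  it contributes to each product in \<open>prod\<close> only a factor independent of
  \<open>j\<close>, which has no effect on vanishing and equals 1 on the diagonal.\<close>

lemma dft_parseval:
  fixes y :: "nat \<Rightarrow> complex" and a :: int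
  assumes m: "m \<ge> 1"
  shows "(\<Sum>j<m. (cmod (\<Sum>l<m. cis (2 * pi * (real_of_int a + real j) * real l / real m) * y l))\<^sup>2)
    = real m * (\<Sum>l<m. (cmod (y l))\<^sup>2)"
proof -
  define c where "c j l = cis (2 * pi * (real_of_int a + real j) * real l / real m)" for j l :: nat
  have prod: "c j l * cnj (c j l') = cis (2 * pi * real_of_int a * (real l - real l') / real m)
      * cis (2 * pi * real j * real_of_int (int l - int l') / real m)" for j l l'
    unfolding c_def cis_cnj cis_mult
    by (rule arg_cong[of _ _ cis]) (use m in \<open>simp add: field_simps\<close>)
  have orth: "(\<Sum>j<m. c j l * cnj (c j l')) = (if l = l' then of_nat m else 0)"
    if "l < m" "l' < m" for l l'
    unfolding prod sum_distrib_left[symmetric]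
    using sum_cis_roots_of_unity[OF m, of "int l - int l'"] that by auto
  have "complex_of_real (\<Sum>j<m. (cmod (\<Sum>l<m. c j l * y l))\<^sup>2)
      = (\<Sum>j<m. (\<Sum>l<m. c j l * y l) * cnj (\<Sum>l<m. c j l * y l))"
    by (simp only: of_real_sum complex_norm_square)
  also have "\<dots> = (\<Sum>j<m. \<Sum>l<m. \<Sum>l'<m. y l * cnj (y l') * (c j l * cnj (c j l')))"
    by (simp add: sum_product mult_ac)
  also have "\<dots> = (\<Sum>l<m. \<Sum>j<m. \<Sum>l'<m. y l * cnj (y l') * (c j l * cnj (c j l')))"
    by (rule sum.swap)
  also have "\<dots> = (\<Sum>l<m. \<Sum>l'<m. \<Sum>j<m. y l * cnj (y l') * (c j l * cnj (c j l')))"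
    by (intro sum.cong refl sum.swap)
  also have "\<dots> = (\<Sum>l<m. \<Sum>l'<m. if l = l' then of_nat m * (y l * cnj (y l')) else 0)"
    by (intro sum.cong refl) (auto simp: sum_distrib_left[symmetric] orth)
  also have "\<dots> = (\<Sum>l<m. of_nat m * (y l * cnj (y l)))"
    by simp
  also have "\<dots> = complex_of_real (real m * (\<Sum>l<m. (cmod (y l))\<^sup>2))"
    by (simp only: of_real_sum of_real_mult complex_norm_square sum_distrib_left of_real_of_nat_eq)
  finally show ?thesis
    unfolding c_def of_real_eq_iff .
qed

text \<open>A window of \<open>n\<close> consecutive frequencies contains \<open>f\<close> and is covered by \<open>c\<close> full periods.\<close>

lemma dft_window_bounds:
  fixes y :: "nat \<Rightarrow> complex" and a :: int
  assumes m: "m \<ge> 1" and f: "f * m \<le> n" and c: "n \<le> c * m"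
  defines "S \<equiv> \<Sum>j<n. (cmod (\<Sum>l<m. cis (2 * pi * (real_of_int a + real j) * real l / real m) * y l))\<^sup>2"
    and "Y \<equiv> \<Sum>l<m. (cmod (y l))\<^sup>2"
  shows "real f * real m * Y \<le> S" and "S \<le> real c * real m * Y"
proof -
  define g where "g j = (cmod (\<Sum>l<m. cis (2 * pi * (real_of_int a + real j) * real l / real m) * y l))\<^sup>2"
    for j :: nat
  have S: "S = sum g {..<n}" by (simp add: S_def g_def)
  \<comment> \<open>The \<open>b\<close>-th block of \<open>m\<close> frequencies starts at
    \<open>a + int (b * m)\<close>, so Parseval applies to it.\<close>
  have block: "(\<Sum>j<m. g (b * m + j)) = real m * Y" for b
    using dft_parseval[OF m, of "a + int (b * m)" y] unfolding g_def Y_def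
    by (simp add: add.assoc)
  have full: "sum g {..<d * m} = real d * real m * Y" for d
  proof -
    have "sum g {..<d * m} = (\<Sum>b<d. sum g {b * m..<b * m + m})"
      by (rule sum.nat_group[symmetric])
    also have "\<dots> = (\<Sum>b<d. real m * Y)"
      by (intro sum.cong refl)
        (simp add: sum.atLeastLessThan_shift_0[of g] block atLeast0LessThan)
    finally show ?thesis by simp
  qed
  \<comment> \<open>All terms are nonnegative, so dropping or adding frequencies changes the sum in
    a known direction.\<close>
  have "sum g {..<f * m} \<le> sum g {..<n}" "sum g {..<n} \<le> sum g {..<c * m}"
    using f c by (auto intro!: sum_mono2 simp: g_def)
  then show "real f * real m * Y \<le> S" and "S \<le> real c * real m * Y"
    by (simp_all add: full S)
qed

section \<open>Perturbation of frame bounds\<close>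

text \<open>A chord is no longer than its arc: its length is 2 |sin((a - b)/2)|.\<close>

lemma cmod_cis_diff_le: "cmod (cis a - cis b) \<le> \<bar>a - b\<bar>"
proof -
  have "(cmod (cis a - cis b))\<^sup>2 = 2 - 2 * cos (a - b)"
    unfolding cmod_power2 cos_diff
    using sin_cos_squared_add[of a] sin_cos_squared_add[of b]
    by (simp add: power2_diff) (simp add: sin_squared_eq)
  also have "\<dots> = (2 * sin ((a - b) / 2))\<^sup>2"
  proof -
    have "2 * ((a - b) / 2) = a - b" by simp
    with cos_double_sin[of "(a - b) / 2"] show ?thesis
      by (simp only: power_mult_distrib) simp
  qed
  also have "\<dots> \<le> (a - b)\<^sup>2"
    using abs_sin_x_le_abs_x[of "(a - b) / 2"] unfolding abs_le_square_iff[symmetric]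
    by (simp add: abs_mult)
  finally show ?thesis
    by (simp add: abs_le_square_iff[symmetric])
qed

text \<open>Cauchy-Schwarz in each row: the Frobenius norm dominates the operator norm.\<close>

lemma frobenius_bound:
  fixes e :: "'i \<Rightarrow> 'j \<Rightarrow> complex"
  assumes \<eta>: "\<And>i j. i \<in> I \<Longrightarrow> j \<in> J \<Longrightarrow> cmod (e i j) \<le> \<eta>"
  shows "(\<Sum>i\<in>I. (cmod (\<Sum>j\<in>J. e i j * x j))\<^sup>2)
    \<le> real (card I) * real (card J) * \<eta>\<^sup>2 * (\<Sum>j\<in>J. (cmod (x j))\<^sup>2)"
proof -
  define X where "X = (\<Sum>j\<in>J. (cmod (x j))\<^sup>2)"
  have "(cmod (\<Sum>j\<in>J. e i j * x j))\<^sup>2 \<le> real (card J) * \<eta>\<^sup>2 * X" if i: "i \<in> I" for i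
  proof -
    have "cmod (\<Sum>j\<in>J. e i j * x j) \<le> (\<Sum>j\<in>J. \<bar>\<eta>\<bar> * \<bar>cmod (x j)\<bar>)"
      by (rule sum_norm_le) (use \<eta>[OF i] in \<open>force simp: norm_mult intro!: mult_right_mono\<close>)
    also have "\<dots> \<le> L2_set (\<lambda>_. \<eta>) J * L2_set (\<lambda>j. cmod (x j)) J"
      by (rule L2_set_mult_ineq)
    finally have "(cmod (\<Sum>j\<in>J. e i j * x j))\<^sup>2 \<le> (L2_set (\<lambda>_. \<eta>) J * L2_set (\<lambda>j. cmod (x j)) J)\<^sup>2"
      by (simp add: power_mono)
    also have "\<dots> = real (card J) * \<eta>\<^sup>2 * X"
      by (simp add: L2_set_constant power_mult_distrib) (simp add: L2_set_def X_def sum_nonneg)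
    finally show ?thesis .
  qed
  from sum_mono[of I, OF this] show ?thesis
    by (simp add: X_def mult_ac)
qed

text \<open>The triangle inequality for the l2 norm in both directions, squared. The sign of the
  last term \<open>V\<close> in the lower bound is the one of the denominators in the
  theorem.\<close>

lemma sum_cmod_square_perturbation:
  fixes u v :: "'i \<Rightarrow> complex"
  assumes U: "L \<le> (\<Sum>i\<in>I. (cmod (u i))\<^sup>2)" "(\<Sum>i\<in>I. (cmod (u i))\<^sup>2) \<le> U"
    and V: "(\<Sum>i\<in>I. (cmod (v i))\<^sup>2) \<le> V"
  shows "L - 2 * sqrt U * sqrt V - V \<le> (\<Sum>i\<in>I. (cmod (u i + v i))\<^sup>2)"
    and "(\<Sum>i\<in>I. (cmod (u i + v i))\<^sup>2) \<le> U + 2 * sqrt U * sqrt V + V"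
proof -
  define n where "n w = L2_set (\<lambda>i. cmod (w i)) I" for w :: "'i \<Rightarrow> complex"
  have sq: "(\<Sum>i\<in>I. (cmod (w i))\<^sup>2) = (n w)\<^sup>2" for w
    by (simp add: n_def L2_set_def sum_nonneg)
  have n0: "0 \<le> n w" for w by (simp add: n_def)
  have tri: "n (\<lambda>i. w i + z i) \<le> n w + n z" for w z
    unfolding n_def
    by (rule order_trans[OF L2_set_mono L2_set_triangle_ineq]) (auto intro: norm_triangle_ineq)
  have "n (\<lambda>i. - v i) = n v" by (simp add: n_def)
  then have lo: "n u \<le> n (\<lambda>i. u i + v i) + n v"
    using tri[of "\<lambda>i. u i + v i" "\<lambda>i. - v i"] by simp
  have nU: "n u \<le> sqrt U" and nV: "n v \<le> sqrt V"
    using U V by (auto simp: sq intro: real_le_rsqrt)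
  then have UV: "n u * n v \<le> sqrt U * sqrt V"
    by (intro mult_mono order_trans[OF n0 nU] n0)
  \<comment> \<open>If \<open>v\<close> is the smaller vector, the reverse triangle inequality may
    be squared. Otherwise the left side is at most 0.\<close>
  have "(n u)\<^sup>2 - 2 * n u * n v - (n v)\<^sup>2 \<le> (n (\<lambda>i. u i + v i))\<^sup>2"
  proof (cases "n v \<le> n u")
    case True
    then have "(n u - n v)\<^sup>2 \<le> (n (\<lambda>i. u i + v i))\<^sup>2"
      using lo by (intro power_mono) auto
    then show ?thesis using zero_le_power2[of "n v"] unfolding power2_diff by linarith
  next
    case False
    then have "(n u)\<^sup>2 \<le> (n v)\<^sup>2" using n0 by (intro power_mono) auto
    moreover have "0 \<le> n u * n v" using n0 by simp
    ultimately show ?thesis using zero_le_power2[of "n (\<lambda>i. u i + v i)"] by linarith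
  qed
  then show "L - 2 * sqrt U * sqrt V - V \<le> (\<Sum>i\<in>I. (cmod (u i + v i))\<^sup>2)"
    using U V UV unfolding sq by linarith
  have "(n (\<lambda>i. u i + v i))\<^sup>2 \<le> (n u + n v)\<^sup>2"
    using tri n0 by (intro power_mono)
  then show "(\<Sum>i\<in>I. (cmod (u i + v i))\<^sup>2) \<le> U + 2 * sqrt U * sqrt V + V"
    using U V UV unfolding sq power2_sum by linarith
qed

text \<open>Apply the previous lemma to u = b x and v = (a - b) x, where \<open>V\<close> bounds the
  squared Frobenius norm of a - b. Every term scales with |x|^2, which can thus be factored
  out.\<close>

lemma frame_perturbation:
  fixes a b :: "'i \<Rightarrow> 'j \<Rightarrow> complex" and x :: "'j \<Rightarrow> complex"
  assumes close: "\<And>i j. i \<in> I \<Longrightarrow> j \<in> J \<Longrightarrow> cmod (a i j - b i j) \<le> \<eta>"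
    and lo: "L * (\<Sum>j\<in>J. (cmod (x j))\<^sup>2) \<le> (\<Sum>i\<in>I. (cmod (\<Sum>j\<in>J. b i j * x j))\<^sup>2)"
    and hi: "(\<Sum>i\<in>I. (cmod (\<Sum>j\<in>J. b i j * x j))\<^sup>2) \<le> U * (\<Sum>j\<in>J. (cmod (x j))\<^sup>2)"
  defines "V \<equiv> real (card I) * real (card J) * \<eta>\<^sup>2"
  shows "(L - 2 * sqrt (U * V) - V) * (\<Sum>j\<in>J. (cmod (x j))\<^sup>2)
      \<le> (\<Sum>i\<in>I. (cmod (\<Sum>j\<in>J. a i j * x j))\<^sup>2)"
    and "(\<Sum>i\<in>I. (cmod (\<Sum>j\<in>J. a i j * x j))\<^sup>2)
      \<le> (U + 2 * sqrt (U * V) + V) * (\<Sum>j\<in>J. (cmod (x j))\<^sup>2)"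
proof -
  define X where "X = (\<Sum>j\<in>J. (cmod (x j))\<^sup>2)"
  have X: "0 \<le> X" by (simp add: X_def sum_nonneg)
  have v: "(\<Sum>i\<in>I. (cmod (\<Sum>j\<in>J. (a i j - b i j) * x j))\<^sup>2) \<le> V * X"
    using frobenius_bound[of I J "\<lambda>i j. a i j - b i j" \<eta> x] close by (simp add: V_def X_def)
  have split: "(\<Sum>j\<in>J. a i j * x j) = (\<Sum>j\<in>J. b i j * x j) + (\<Sum>j\<in>J. (a i j - b i j) * x j)" for i
    by (simp add: left_diff_distrib sum_subtractf)
  have sq: "sqrt (U * X) * sqrt (V * X) = sqrt (U * V) * X"
    using X by (simp add: real_sqrt_mult)
  note pert = sum_cmod_square_perturbation[OF lo[folded X_def] hi[folded X_def] v]
  show "(L - 2 * sqrt (U * V) - V) * X \<le> (\<Sum>i\<in>I. (cmod (\<Sum>j\<in>J. a i j * x j))\<^sup>2)"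
    using pert(1) sq unfolding split[symmetric] by (simp add: algebra_simps)
  show "(\<Sum>i\<in>I. (cmod (\<Sum>j\<in>J. a i j * x j))\<^sup>2) \<le> (U + 2 * sqrt (U * V) + V) * X"
    using pert(2) sq unfolding split[symmetric] by (simp add: algebra_simps)
qed

section \<open>The sampling matrix\<close>

lemma sampling_matrix_carrier: "sampling_matrix q m d \<in> carrier_mat m (2 * q + 1)"
  by (simp add: sampling_matrix_def)

lemma sampling_matrix_index:
  assumes "i < m" "j < 2 * q + 1"
  shows "sampling_matrix q m d $$ (i, j)
    = cis (2 * pi * (real j - real q) * (real i / real m + d (i + 1)))"
  using assms by (simp add: sampling_matrix_def sample_point_def cis_conv_exp mult_ac)

text \<open>The shift changes the phase by 2 pi |k| \<open>d (i + 1)\<close> with k = j - q, and 2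
  |k| is at most 2q.\<close>

lemma sampling_matrix_perturbation:
  assumes i: "i < m" and j: "j < 2 * q + 1" and d: "0 < d (i + 1)" "d (i + 1) < T"
  shows "cmod (sampling_matrix q m d $$ (i, j) - cis (2 * pi * (real j - real q) * real i / real m))
    \<le> pi * real (2 * q + 1) * T"
proof -
  have "cmod (sampling_matrix q m d $$ (i, j) - cis (2 * pi * (real j - real q) * real i / real m))
      \<le> \<bar>2 * pi * (real j - real q) * (real i / real m + d (i + 1))
          - 2 * pi * (real j - real q) * real i / real m\<bar>"
    unfolding sampling_matrix_index[OF i j] by (rule cmod_cis_diff_le)
  also have "\<dots> = \<bar>2 * pi * (real j - real q) * d (i + 1)\<bar>"
    by (rule arg_cong[of _ _ abs]) (simp add: distrib_left)
  also have "\<dots> = pi * (2 * \<bar>real j - real q\<bar>) * d (i + 1)"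
    using d by (simp add: abs_mult)
  also have "\<dots> \<le> pi * real (2 * q + 1) * T"
  proof -
    have "2 * \<bar>real j - real q\<bar> \<le> real (2 * q + 1)"
      using j by (simp add: abs_if)
    then show ?thesis using d by (intro mult_mono) auto
  qed
  finally show ?thesis .
qed

text \<open>For equispaced points the Gram matrix is exactly \<open>m\<close> times the identity, so
  both unperturbed frame bounds equal \<open>m\<close>. Here Parseval is used with the row index as
  frequency and the column index as summation variable.\<close>

lemma sampling_matrix_frame_tall:
  fixes x :: "nat \<Rightarrow> complex"
  assumes m: "m \<ge> 1" and N: "N = 2 * q + 1" and le: "N \<le> m"
    and d: "\<And>i. i \<in> {1..m} \<Longrightarrow> 0 < d i \<and> d i < T"
  defines "V \<equiv> real m * real N * (pi * real N * T)\<^sup>2"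
  shows "(real m - 2 * sqrt (real m * V) - V) * (\<Sum>j<N. (cmod (x j))\<^sup>2)
      \<le> (\<Sum>i<m. (cmod (\<Sum>j<N. sampling_matrix q m d $$ (i, j) * x j))\<^sup>2)"
    and "(\<Sum>i<m. (cmod (\<Sum>j<N. sampling_matrix q m d $$ (i, j) * x j))\<^sup>2)
      \<le> (real m + 2 * sqrt (real m * V) + V) * (\<Sum>j<N. (cmod (x j))\<^sup>2)"
proof -
  define b where "b i j = cis (2 * pi * (real j - real q) * real i / real m)" for i j :: nat
  \<comment> \<open>Zero padding to length \<open>m\<close>, the length that Parseval
    requires.\<close>
  define y where "y j = (if j < N then x j else 0)" for j
  have pad: "(\<Sum>j<m. g j * y j) = (\<Sum>j<N. g j * x j)" for g :: "nat \<Rightarrow> complex"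
    by (rule sum.mono_neutral_cong_right) (use le in \<open>auto simp: y_def\<close>)
  have pad2: "(\<Sum>j<m. (cmod (y j))\<^sup>2) = (\<Sum>j<N. (cmod (x j))\<^sup>2)"
    by (rule sum.mono_neutral_cong_right) (use le in \<open>auto simp: y_def\<close>)
  have "cmod (\<Sum>j<N. b i j * x j)
      = cmod (\<Sum>j<m. cis (2 * pi * (real_of_int 0 + real i) * real j / real m) * y j)" for i
  proof -
    \<comment> \<open>A unimodular factor common to row \<open>i\<close> moves the exponents from
      -q, ..., q to 0, ..., 2q.\<close>
    have "b i j = cis (- (2 * pi * real q * real i / real m))
        * cis (2 * pi * (real_of_int 0 + real i) * real j / real m)" for j
      unfolding b_def cis_mult by (rule arg_cong[of _ _ cis]) (simp add: diff_divide_distrib algebra_simps)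
    then have "(\<Sum>j<N. b i j * x j) = cis (- (2 * pi * real q * real i / real m))
        * (\<Sum>j<N. cis (2 * pi * (real_of_int 0 + real i) * real j / real m) * x j)"
      by (simp add: sum_distrib_left mult.assoc)
    then show ?thesis by (simp only: norm_mult norm_cis pad mult_1)
  qed
  then have eq: "(\<Sum>i<m. (cmod (\<Sum>j<N. b i j * x j))\<^sup>2) = real m * (\<Sum>j<N. (cmod (x j))\<^sup>2)"
    using dft_parseval[OF m, of 0 y] by (simp only: pad2)
  have close: "cmod (sampling_matrix q m d $$ (i, j) - b i j) \<le> pi * real N * T"
    if "i \<in> {..<m}" "j \<in> {..<N}" for i j
    using that d[of "i + 1"] unfolding b_def N
    by (intro sampling_matrix_perturbation) auto
  note fp = frame_perturbation[where I = "{..<m}" and J = "{..<N}", OF close eq_refl[OF eq[symmetric]] eq_refl[OF eq]]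
  show "(real m - 2 * sqrt (real m * V) - V) * (\<Sum>j<N. (cmod (x j))\<^sup>2)
      \<le> (\<Sum>i<m. (cmod (\<Sum>j<N. sampling_matrix q m d $$ (i, j) * x j))\<^sup>2)"
    using fp(1) by (simp only: card_lessThan V_def)
  show "(\<Sum>i<m. (cmod (\<Sum>j<N. sampling_matrix q m d $$ (i, j) * x j))\<^sup>2)
      \<le> (real m + 2 * sqrt (real m * V) + V) * (\<Sum>j<N. (cmod (x j))\<^sup>2)"
    using fp(2) by (simp only: card_lessThan V_def)
qed

text \<open>The rows of the adjoint carry the \<open>N\<close> consecutive frequencies -q, ..., q,
  so the window bounds with \<open>a = - int q\<close> give the unperturbed frame bounds
  \<open>f * m\<close> and \<open>c * m\<close>.\<close>

lemma sampling_matrix_frame_wide: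
  fixes x :: "nat \<Rightarrow> complex"
  assumes m: "m \<ge> 1" and N: "N = 2 * q + 1" and f: "f * m \<le> N" and c: "N \<le> c * m"
    and d: "\<And>i. i \<in> {1..m} \<Longrightarrow> 0 < d i \<and> d i < T"
  defines "A \<equiv> sampling_matrix q m d"
  defines "V \<equiv> real N * real m * (pi * real N * T)\<^sup>2"
  shows "(real f * real m - 2 * sqrt (real c * real m * V) - V) * (\<Sum>i<m. (cmod (x i))\<^sup>2)
      \<le> (\<Sum>j<N. (cmod (\<Sum>i<m. mat_adjoint A $$ (j, i) * x i))\<^sup>2)"
    and "(\<Sum>j<N. (cmod (\<Sum>i<m. mat_adjoint A $$ (j, i) * x i))\<^sup>2)
      \<le> (real c * real m + 2 * sqrt (real c * real m * V) + V) * (\<Sum>i<m. (cmod (x i))\<^sup>2)"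
proof -
  define b where "b j i = cis (2 * pi * (real j - real q) * real i / real m)" for i j :: nat
  define X where "X = (\<Sum>i<m. (cmod (x i))\<^sup>2)"
  have A: "A \<in> carrier_mat m N"
    unfolding A_def N by (rule sampling_matrix_carrier)
  have adj: "mat_adjoint A $$ (j, i) = cnj (A $$ (i, j))" if "i < m" "j < N" for i j
    using mat_adjoint_index[OF A that(2,1)] by simp
  \<comment> \<open>Conjugating the whole sum moves the conjugate from the exponentials to
    \<open>x\<close>, without changing either norm.\<close>
  have "cmod (\<Sum>i<m. cnj (b j i) * x i)
      = cmod (\<Sum>i<m. cis (2 * pi * (real_of_int (- int q) + real j) * real i / real m) * cnj (x i))" for j
    by (subst complex_mod_cnj[symmetric]) (simp add: b_def)
  then have eq: "(\<Sum>j<N. (cmod (\<Sum>i<m. cnj (b j i) * x i))\<^sup>2) = (\<Sum>j<N. (cmod (\<Sum>i<m.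
      cis (2 * pi * (real_of_int (- int q) + real j) * real i / real m) * cnj (x i)))\<^sup>2)"
    by simp
  have cX: "(\<Sum>i<m. (cmod (cnj (x i)))\<^sup>2) = X" by (simp add: X_def)
  note w = dft_window_bounds[OF m f c, where a = "- int q" and y = "\<lambda>i. cnj (x i)", folded eq, unfolded cX]
  have close: "cmod (mat_adjoint A $$ (j, i) - cnj (b j i)) \<le> pi * real N * T"
    if "j \<in> {..<N}" "i \<in> {..<m}" for i j
  proof -
    have "mat_adjoint A $$ (j, i) - cnj (b j i) = cnj (A $$ (i, j) - b j i)"
      using that by (simp add: adj)
    then have "cmod (mat_adjoint A $$ (j, i) - cnj (b j i)) = cmod (A $$ (i, j) - b j i)"
      by (simp only: complex_mod_cnj)
    also have "\<dots> \<le> pi * real N * T"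
      using that d[of "i + 1"] unfolding b_def N A_def
      by (intro sampling_matrix_perturbation) auto
    finally show ?thesis .
  qed
  note fp = frame_perturbation[where I = "{..<N}" and J = "{..<m}", OF close w(1)[unfolded X_def] w(2)[unfolded X_def]]
  show "(real f * real m - 2 * sqrt (real c * real m * V) - V) * (\<Sum>i<m. (cmod (x i))\<^sup>2)
      \<le> (\<Sum>j<N. (cmod (\<Sum>i<m. mat_adjoint A $$ (j, i) * x i))\<^sup>2)"
    using fp(1) by (simp only: card_lessThan V_def)
  show "(\<Sum>j<N. (cmod (\<Sum>i<m. mat_adjoint A $$ (j, i) * x i))\<^sup>2)
      \<le> (real c * real m + 2 * sqrt (real c * real m * V) + V) * (\<Sum>i<m. (cmod (x i))\<^sup>2)"
    using fp(2) by (simp only: card_lessThan V_def)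
qed

section \<open>Injectivity and rank of the sampling matrix\<close>

lemma cis_2pi_inj_on: "inj_on (\<lambda>t. cis (2 * pi * t)) {0..<1}"
proof (rule inj_onI)
  fix s t :: real
  assume st: "s \<in> {0..<1}" "t \<in> {0..<1}" and eq: "cis (2 * pi * s) = cis (2 * pi * t)"
  have "cis (2 * pi * s - 2 * pi * t) = 1"
    by (simp add: cis_divide[symmetric] eq)
  then have "cos (2 * pi * (s - t)) = 1"
    by (simp add: complex_eq_iff right_diff_distrib)
  then obtain n :: int where "2 * pi * (s - t) = real_of_int n * 2 * pi"
    using cos_one_2pi_int by blast
  then have n: "s - t = real_of_int n" by simp
  with st have "-1 < real_of_int n" "real_of_int n < 1" by auto
  then have "n = 0" by linarith
  with n show "s = t" by simp
qed

text \<open>Vandermonde: a kernel vector is the coefficient sequence of a polynomial of degree below \<open>n\<close>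
  with \<open>m \<ge> n\<close> distinct roots on the unit circle.\<close>

lemma sampling_matrix_kernel:
  fixes x :: "nat \<Rightarrow> complex"
  assumes t: "inj_on (sample_point m d) {1..m}" "sample_point m d ` {1..m} \<subseteq> {0..<1}"
    and n: "n \<le> m" "n \<le> 2 * q + 1"
    and ker: "\<And>i. i < m \<Longrightarrow> (\<Sum>j<n. sampling_matrix q m d $$ (i, j) * x j) = 0"
    and j: "j < n"
  shows "x j = 0"
proof -
  define z where "z l = cis (2 * pi * sample_point m d l)" for l
  define p where "p = (\<Sum>j<n. monom (x j) j)"
  have root: "poly p (z l) = 0" if l: "l \<in> {1..m}" for l
  proof -
    obtain i where i: "l = i + 1" "i < m" using l by (cases l) auto
    \<comment> \<open>Taking the lowest frequency -q out of the row leaves the nonnegative powers of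
      a Vandermonde row.\<close>
    have ent: "sampling_matrix q m d $$ (i, k) = cis (- (2 * pi * real q * sample_point m d l)) * z l ^ k"
      if "k < n" for k
    proof -
      have "cis (2 * pi * (real k - real q) * sample_point m d l)
          = cis (- (2 * pi * real q * sample_point m d l)) * z l ^ k"
        unfolding z_def Complex.DeMoivre cis_mult
        by (rule arg_cong[of _ _ cis]) (simp add: algebra_simps)
      then show ?thesis
        using sampling_matrix_index[of i m k q d] that n i by (simp add: sample_point_def)
    qed
    have "cis (- (2 * pi * real q * sample_point m d l)) * poly p (z l)
        = (\<Sum>k<n. sampling_matrix q m d $$ (i, k) * x k)"
      unfolding p_def poly_sum poly_monom sum_distrib_left
      by (intro sum.cong refl) (simp add: ent)
    then show ?thesis using ker[OF i(2)] by simp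
  qed
  have "inj_on z {1..m}"
    unfolding z_def using comp_inj_on[OF t(1) inj_on_subset[OF cis_2pi_inj_on t(2)]] by (simp only: o_def)
  then have card: "card (z ` {1..m}) = m"
    by (simp add: card_image)
  have "degree p \<le> n - 1"
    unfolding p_def
    by (rule degree_sum_le) (auto intro: order_trans[OF degree_monom_le])
  then have "degree p < m" using j n by simp
  then have "p = 0"
    using card root by (intro poly_eqI_degree[of "z ` {1..m}"]) auto
  then have "coeff p j = 0" by simp
  then show ?thesis using j by (simp add: p_def coeff_sum)
qed

lemma (in vec_space) rank_le_dim:
  assumes A: "A \<in> carrier_mat n nc"
  shows "rank A \<le> n"
proof -
  obtain S where S: "maximal S (\<lambda>T. T \<subseteq> set (cols A) \<and> lin_indpt T)"
    using maximal_exists_superset[of "set (cols A)" "\<lambda>T. T \<subseteq> set (cols A) \<and> lin_indpt T" "{}"]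
    by (metis List.finite_set empty_subsetI finite_lin_indpt2 finite.emptyI empty_iff)
  then have "S \<subseteq> carrier_vec n" "lin_indpt S"
    using cols_dim A unfolding maximal_def by blast+
  then have "card S \<le> n"
    using li_le_dim(2)[of S] dim_is_n by simp
  then show ?thesis
    using rank_card_indpt[OF A S] by simp
qed

text \<open>The first \<open>n\<close> columns are linearly independent. Independence is a property
  of a set of columns, so they must also be shown distinct before they count as \<open>n\<close>
  vectors.\<close>

lemma rank_of_injective_columns:
  fixes A :: "complex mat"
  assumes A: "A \<in> carrier_mat m N" and n: "n \<le> N"
    and inj: "\<And>x j. (\<And>i. i < m \<Longrightarrow> (\<Sum>j<n. A $$ (i, j) * x j) = 0) \<Longrightarrow> j < n \<Longrightarrow> x j = 0"
  shows "n \<le> vec_space.rank m A"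
proof -
  interpret vec_space "TYPE(complex)" m .
  define B where "B = mat m n (\<lambda>(i, j). A $$ (i, j))"
  have B: "B \<in> carrier_mat m n" by (simp add: B_def)
  have colB: "col B j = col A j" if "j < n" for j
    using that A n by (auto simp: B_def)
  have sub: "set (cols B) \<subseteq> set (cols A)"
  proof
    fix v assume "v \<in> set (cols B)"
    then obtain j where "j < n" "v = col B j"
      using B by (auto simp: cols_def)
    then show "v \<in> set (cols A)"
      using colB A n by (auto simp: cols_def)
  qed
  have dist: "distinct (cols B)"
  proof (rule ccontr)
    assume "\<not> distinct (cols B)"
    then obtain j k where jk: "j < n" "k < n" "j \<noteq> k" "col B j = col B k"
      using B by (auto simp: distinct_conv_nth)
    \<comment> \<open>Equal columns \<open>j\<close> and \<open>k\<close> would put the difference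
      of two unit vectors into the kernel.\<close>
    define x :: "nat \<Rightarrow> complex" where "x l = (if l = j then 1 else 0) - (if l = k then 1 else 0)" for l
    have "(\<Sum>l<n. A $$ (i, l) * x l) = 0" if i: "i < m" for i
    proof -
      have "(\<Sum>l<n. A $$ (i, l) * x l) = A $$ (i, j) - A $$ (i, k)"
        using jk by (simp add: x_def right_diff_distrib sum_subtractf if_distrib[of "\<lambda>y. _ * y"] cong: if_cong)
      also have "\<dots> = col B j $ i - col B k $ i"
        using i jk(1,2) A n by (simp add: B_def)
      finally show ?thesis unfolding jk(4) by simp
    qed
    from inj[OF this jk(1)] jk(3) show False by (simp add: x_def)
  qed
  have "lin_indpt (set (cols B))"
  proof
    assume "lin_dep (set (cols B))"
    from lin_depE[OF B this dist] obtain v where v: "v \<in> carrier_vec n" "v \<noteq> 0\<^sub>v n" "B *\<^sub>v v = 0\<^sub>v m" .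
    have "(\<Sum>j<n. A $$ (i, j) * v $ j) = 0" if i: "i < m" for i
    proof -
      have "(B *\<^sub>v v) $ i = 0" using v i by simp
      then show ?thesis using i v B by (simp add: scalar_prod_def lessThan_atLeast0 B_def)
    qed
    then have "v $ j = 0" if "j < n" for j
      using inj[of "\<lambda>j. v $ j"] that by blast
    then show False using nonzero_vec_index[OF v(1,2)] by blast
  qed
  from rank_ge_card_indpt[OF A sub this] show ?thesis
    using distinct_card[OF dist] B by simp
qed

text \<open>The conjugate of a kernel vector of the adjoint is annihilated by the transpose of the
  leading square block \<open>B\<close>. Then \<open>det B = 0\<close>, and \<open>B\<close> itself
  has a kernel vector, against \<open>inj\<close>.\<close>

lemma mat_adjoint_injective:
  fixes A :: "complex mat"
  assumes A: "A \<in> carrier_mat m N" and n: "m \<le> N"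
    and inj: "\<And>x j. (\<And>i. i < m \<Longrightarrow> (\<Sum>j<m. A $$ (i, j) * x j) = 0) \<Longrightarrow> j < m \<Longrightarrow> x j = 0"
    and y: "y \<in> carrier_vec m" "mat_adjoint A *\<^sub>v y = 0\<^sub>v N"
  shows "y = 0\<^sub>v m"
proof (rule ccontr)
  assume y0: "y \<noteq> 0\<^sub>v m"
  define B where "B = mat m m (\<lambda>(i, j). A $$ (i, j))"
  have B: "B \<in> carrier_mat m m" by (simp add: B_def)
  define w where "w = vec m (\<lambda>i. cnj (y $ i))"
  have w: "w \<in> carrier_vec m" by (simp add: w_def)
  obtain i where "i < m" "y $ i \<noteq> 0" using nonzero_vec_index[OF y(1) y0] by blast
  then have w0: "w \<noteq> 0\<^sub>v m"
    by (metis w_def index_vec index_zero_vec(1) complex_cnj_zero_iff)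
  have "B\<^sup>T *\<^sub>v w = 0\<^sub>v m"
  proof (rule eq_vecI)
    fix j assume "j < dim_vec (0\<^sub>v m :: complex vec)"
    then have j: "j < m" "j < N" using n by auto
    have "(\<Sum>i<m. cnj (A $$ (i, j)) * y $ i) = (mat_adjoint A *\<^sub>v y) $ j"
      using A y(1) j mat_adjoint_index[OF A j(2)] by (simp add: scalar_prod_def lessThan_atLeast0)
    then have "(\<Sum>i<m. cnj (A $$ (i, j)) * y $ i) = 0"
      using j by (simp add: y(2))
    then have "cnj (\<Sum>i<m. A $$ (i, j) * w $ i) = 0"
      by (simp add: w_def)
    then have "(\<Sum>i<m. A $$ (i, j) * w $ i) = 0"
      by (simp only: complex_cnj_zero_iff)
    then show "(B\<^sup>T *\<^sub>v w) $ j = 0\<^sub>v m $ j"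
      using j w by (simp add: B_def scalar_prod_def lessThan_atLeast0)
  qed (simp add: B_def)
  then have "det B = 0"
    using det_0_iff_vec_prod_zero_field[of "B\<^sup>T" m] B w w0 det_transpose[OF B] by auto
  then obtain v where v: "v \<in> carrier_vec m" "v \<noteq> 0\<^sub>v m" "B *\<^sub>v v = 0\<^sub>v m"
    using det_0_iff_vec_prod_zero_field[OF B] by auto
  have "(\<Sum>j<m. A $$ (i, j) * v $ j) = 0" if i: "i < m" for i
  proof -
    have "(B *\<^sub>v v) $ i = 0" using v i by simp
    then show ?thesis using i v(1) B by (simp add: scalar_prod_def lessThan_atLeast0 B_def)
  qed
  then have "v $ j = 0" if "j < m" for j
    using inj[of "\<lambda>j. v $ j"] that by blast
  then show False using nonzero_vec_index[OF v(1,2)] by blast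
qed

section \<open>Reciprocal sums, constants and position of the sample points\<close>

lemma sum_inverse_nth_bounds:
  fixes xs :: "real list"
  assumes "\<forall>s\<in>set xs. 0 < s \<and> L \<le> s \<and> s \<le> U" and "0 < L"
  shows "real (length xs) / U \<le> (\<Sum>i = 1..length xs. 1 / xs ! (i - 1))"
    and "(\<Sum>i = 1..length xs. 1 / xs ! (i - 1)) \<le> real (length xs) / L"
proof -
  have b: "1 / U \<le> 1 / xs ! (i - 1) \<and> 1 / xs ! (i - 1) \<le> 1 / L" if "i \<in> {1..length xs}" for i
  proof -
    have "xs ! (i - 1) \<in> set xs" using that by (intro nth_mem) auto
    from bspec[OF assms(1) this] assms(2) show ?thesis by (auto intro!: divide_left_mono)
  qed
  have "real (card {1..length xs}) * (1 / U) \<le> (\<Sum>i = 1..length xs. 1 / xs ! (i - 1))"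
    using b by (intro sum_bounded_below) auto
  moreover have "(\<Sum>i = 1..length xs. 1 / xs ! (i - 1)) \<le> real (card {1..length xs}) * (1 / L)"
    using b by (intro sum_bounded_above) auto
  ultimately show "real (length xs) / U \<le> (\<Sum>i = 1..length xs. 1 / xs ! (i - 1))"
    and "(\<Sum>i = 1..length xs. 1 / xs ! (i - 1)) \<le> real (length xs) / L"
    by simp_all
qed

lemma powr_three_halves_square:
  fixes a :: real
  assumes "0 \<le> a"
  shows "(a powr (3/2))\<^sup>2 = a ^ 3"
  using assms by (cases "a = 0") (simp_all add: powr_power)

lemma sqrt_frame_constant:
  assumes "0 \<le> T" and "0 \<le> c" and V: "V = real m * (pi * n powr (3/2) * T)\<^sup>2"
  shows "sqrt (c * real m * V) = real m * (sqrt c * (pi * n powr (3/2) * T))"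
proof (rule real_sqrt_unique)
  show "(real m * (sqrt c * (pi * n powr (3/2) * T)))\<^sup>2 = c * real m * V"
    using assms(2) by (simp add: V power_mult_distrib power2_eq_square)
qed (use assms in simp)

lemma sample_point_window:
  assumes l: "l \<in> {1..m}" and d: "0 < d l" "d l < 1 / real m"
  shows "(real l - 1) / real m < sample_point m d l" and "sample_point m d l < real l / real m"
  using assms by (auto simp: sample_point_def diff_divide_distrib)

text \<open>Each point stays inside its own cell between (l - 1)/m and l/m.\<close>

lemma sample_point_strict_mono:
  assumes d: "\<And>l. l \<in> {1..m} \<Longrightarrow> 0 < d l \<and> d l < 1 / real m"
  shows "strict_mono_on {1..m} (sample_point m d)"
proof (rule strict_mono_onI)
  fix k l assume kl: "k \<in> {1..m}" "l \<in> {1..m}" "k < l"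
  have "sample_point m d k < real k / real m"
    using sample_point_window(2)[of k m d] d kl by blast
  also have "\<dots> \<le> (real l - 1) / real m"
    using kl by (intro divide_right_mono) auto
  also have "\<dots> < sample_point m d l"
    using sample_point_window(1)[of l m d] d kl by blast
  finally show "sample_point m d k < sample_point m d l" .
qed

lemma sample_point_unit_interval:
  assumes d: "\<And>l. l \<in> {1..m} \<Longrightarrow> 0 < d l \<and> d l < 1 / real m"
  shows "sample_point m d ` {1..m} \<subseteq> {0..<1}"
proof
  fix s assume "s \<in> sample_point m d ` {1..m}"
  then obtain l where l: "l \<in> {1..m}" and s: "s = sample_point m d l" by blast
  have "0 \<le> (real l - 1) / real m" "real l / real m \<le> 1"
    using l by auto
  moreover have "(real l - 1) / real m < sample_point m d l" "sample_point m d l < real l / real m"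
    using sample_point_window[of l m d] l d by blast+
  ultimately show "s \<in> {0..<1}"
    unfolding s atLeastLessThan_iff by linarith
qed

section \<open>Bounds for the sum of reciprocal singular values\<close>

theorem theorem13:
  fixes q m N r :: nat
    and T :: real
    and \<delta> t \<sigma> :: "nat \<Rightarrow> real"
    and A :: "complex mat"
  assumes m: "m \<ge> 1"
    and N: "N = 2 * q + 1"
    and T: "0 < T" "T < 1 / real m"
    and \<delta>: "\<And>l. l \<in> {1..m} \<Longrightarrow> 0 < \<delta> l \<and> \<delta> l < T"
    and t: "t = sample_point m \<delta>"
    and A: "A = sampling_matrix q m \<delta>"
    and r: "r = vec_space.rank m A"
    and \<sigma>: "\<sigma> = (\<lambda>i. nonzero_singular_value i (A * mat_adjoint A))"
  shows
    "strict_mono_on {1..m} t \<and>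
     r = min m N \<and>
     length (nonzero_singular_values (A * mat_adjoint A)) = r \<and>
     (N \<le> m \<and>
      T < min (1 / real m) (1 / ((sqrt 2 + 1) * pi * real N powr (3/2))) \<longrightarrow>
        real N / (real m * (1 + 2 * pi * real N powr (3/2) * T + pi^2 * real N ^ 3 * T^2))
          \<le> (\<Sum>i = 1..r. 1 / \<sigma> i) \<and>
        (\<Sum>i = 1..r. 1 / \<sigma> i)
          \<le> real N / (real m * (1 - 2 * pi * real N powr (3/2) * T - pi^2 * real N ^ 3 * T^2))) \<and>
     (m < N \<and>
      T < min (1 / real m)
            ((sqrt (2 * real N) - sqrt (real N + real m)) / (pi * sqrt (real m) * real N powr (3/2))) \<longrightarrow>
        1 / (of_int \<lceil>real N / real m\<rceil>
             + 2 * pi * sqrt (of_int \<lceil>real N / real m\<rceil>) * real N powr (3/2) * T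
             + pi^2 * real N ^ 3 * T^2)
          \<le> (\<Sum>i = 1..r. 1 / \<sigma> i) \<and>
        (\<Sum>i = 1..r. 1 / \<sigma> i)
          \<le> 1 / (of_int \<lfloor>real N / real m\<rfloor>
             - 2 * pi * sqrt (of_int \<lceil>real N / real m\<rceil>) * real N powr (3/2) * T
             - pi^2 * real N ^ 3 * T^2))"
proof -
  \<comment> \<open>Chosen so that the Frobenius bound m N (pi N T)^2 becomes m \<epsilon>^2, which
    makes every frame constant a multiple of \<open>m\<close>.\<close>
  define \<epsilon> where "\<epsilon> = pi * real N powr (3/2) * T"
  have \<epsilon>: "0 \<le> \<epsilon>" using T by (simp add: \<epsilon>_def)
  have \<epsilon>2: "pi^2 * real N ^ 3 * T^2 = \<epsilon>\<^sup>2"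
    by (simp add: \<epsilon>_def power_mult_distrib powr_three_halves_square)
  have twice: "2 * pi * real N powr (3/2) * T = 2 * \<epsilon>"
    "2 * pi * s * real N powr (3/2) * T = 2 * (s * \<epsilon>)" for s
    by (simp_all add: \<epsilon>_def)
  have V: "real m * real N * (pi * real N * T)\<^sup>2 = real m * \<epsilon>\<^sup>2"
    "real N * real m * (pi * real N * T)\<^sup>2 = real m * \<epsilon>\<^sup>2"
    unfolding \<epsilon>2[symmetric] by (simp_all add: power_mult_distrib power2_eq_square power3_eq_cube)
  have sq: "sqrt (real c * real m * (real m * \<epsilon>\<^sup>2)) = real m * (sqrt (real c) * \<epsilon>)" for c
    using sqrt_frame_constant[of T "real c" _ m "real N"] T by (simp add: \<epsilon>_def)
  have d: "0 < \<delta> l \<and> \<delta> l < 1 / real m" if "l \<in> {1..m}" for l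
    using \<delta>[OF that] T by linarith
  have mono: "strict_mono_on {1..m} (sample_point m \<delta>)"
    by (rule sample_point_strict_mono[OF d])
  have Ac: "A \<in> carrier_mat m N"
    unfolding A N by (rule sampling_matrix_carrier)
  \<comment> \<open>Kept general in \<open>n\<close>: the cases \<open>N\<close>, \<open>m\<close>
    and \<open>min m N\<close> serve the tall matrix, the adjoint and the rank.\<close>
  have ker: "x j = 0"
    if "\<And>i. i < m \<Longrightarrow> (\<Sum>j<n. A $$ (i, j) * x j) = 0" "j < n" "n \<le> m" "n \<le> N"
    for n j and x :: "nat \<Rightarrow> complex"
    using sampling_matrix_kernel[OF strict_mono_on_imp_inj_on[OF mono] sample_point_unit_interval[OF d] that(3)]
      that unfolding A N by blast
  interpret vec_space "TYPE(complex)" m .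
  have rank: "r = min m N"
    using rank_le_nc[OF Ac] rank_le_dim[OF Ac]
      rank_of_injective_columns[OF Ac, of "min m N"] ker[where n = "min m N"]
    unfolding r by (intro antisym) auto
  note A' = mat_adjoint_carrier[OF Ac]
  define H where "H = A * mat_adjoint A"
  have H: "H \<in> carrier_mat m m" unfolding H_def using Ac A' by auto
  have herm: "mat_adjoint H = H"
    using mat_adjoint_mult_self[OF A'] by (simp add: H_def)
  define xs where "xs = nonzero_singular_values H"
  have \<sigma>xs: "\<sigma> i = xs ! (i - 1)" for i
    by (simp add: \<sigma> xs_def H_def nonzero_singular_value_def)

  have tall: "length xs = N \<and> (\<forall>s\<in>set xs. 0 < s \<and> real m * (1 - 2 * \<epsilon> - \<epsilon>\<^sup>2) \<le> s
      \<and> s \<le> real m * (1 + 2 * \<epsilon> + \<epsilon>\<^sup>2))" if le: "N \<le> m"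
  proof -
    have inj: "x = 0\<^sub>v N" if "x \<in> carrier_vec N" "A *\<^sub>v x = 0\<^sub>v m" for x
    proof (rule ccontr)
      assume "x \<noteq> 0\<^sub>v N"
      have "(\<Sum>j<N. A $$ (i, j) * x $ j) = 0" if "i < m" for i
      proof -
        have "(A *\<^sub>v x) $ i = 0" using \<open>A *\<^sub>v x = 0\<^sub>v m\<close> that by simp
        then show ?thesis
          using Ac \<open>x \<in> carrier_vec N\<close> that by (simp add: scalar_prod_def lessThan_atLeast0)
      qed
      then have "x $ j = 0" if "j < N" for j
        using ker[where n = N and x = "\<lambda>j. x $ j"] that le by blast
      then show False
        using nonzero_vec_index[OF \<open>x \<in> carrier_vec N\<close> \<open>x \<noteq> 0\<^sub>v N\<close>] by blast
    qed
    have sv: "length xs = N" "s \<in> set xs \<Longrightarrow> 0 < s \<and> poly (char_poly (mat_adjoint A * A)) (complex_of_real s) = 0" for s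
      unfolding xs_def
      by (rule nonzero_singular_values_gram[OF H herm Ac
            proots_char_poly_mult_commute[OF Ac A' le, folded H_def]]; use inj in blast)+
    note frame = sampling_matrix_frame_tall[where d = \<delta> and T = T, OF m N le \<delta>, folded A, unfolded V]
    have sq1: "sqrt (real m * (real m * \<epsilon>\<^sup>2)) = real m * \<epsilon>"
      using sq[of 1] by simp
    have "0 < s \<and> real m * (1 - 2 * \<epsilon> - \<epsilon>\<^sup>2) \<le> s \<and> s \<le> real m * (1 + 2 * \<epsilon> + \<epsilon>\<^sup>2)" if "s \<in> set xs" for s
      using gram_eigenvalue_bounds[OF Ac conjunct2[OF sv(2)[OF that]] frame] sv(2)[OF that]
      by (simp add: sq1 algebra_simps)
    with sv(1) show ?thesis by blast
  qed

  have wide: "length xs = m \<and> (\<forall>s\<in>set xs. 0 < s \<and> real m * (real f - 2 * (sqrt (real c) * \<epsilon>) - \<epsilon>\<^sup>2) \<le> s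
      \<and> s \<le> real m * (real c + 2 * (sqrt (real c) * \<epsilon>) + \<epsilon>\<^sup>2))"
    if le: "m \<le> N" and f: "f * m \<le> N" and c: "N \<le> c * m" for f c
  proof -
    have inj: "y = 0\<^sub>v m" if "y \<in> carrier_vec m" "mat_adjoint A *\<^sub>v y = 0\<^sub>v N" for y
      using mat_adjoint_injective[OF Ac le _ that] ker[where n = m] le by blast
    \<comment> \<open>Here \<open>H\<close> already is the Gram matrix of the adjoint, so no zeros
      split off.\<close>
    have spec: "proots (char_poly H)
        = replicate_mset 0 0 + proots (char_poly (mat_adjoint (mat_adjoint A) * mat_adjoint A))"
      by (simp add: H_def)
    have sv: "length xs = m" "s \<in> set xs \<Longrightarrow> 0 < s \<and>
        poly (char_poly (mat_adjoint (mat_adjoint A) * mat_adjoint A)) (complex_of_real s) = 0" for s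
      unfolding xs_def
      by (rule nonzero_singular_values_gram[OF H herm A' spec]; use inj in blast)+
    note frame = sampling_matrix_frame_wide[where d = \<delta> and T = T, OF m N f c \<delta>, folded A, unfolded V sq]
    have "0 < s \<and> real m * (real f - 2 * (sqrt (real c) * \<epsilon>) - \<epsilon>\<^sup>2) \<le> s
        \<and> s \<le> real m * (real c + 2 * (sqrt (real c) * \<epsilon>) + \<epsilon>\<^sup>2)" if "s \<in> set xs" for s
      using gram_eigenvalue_bounds[OF A' conjunct2[OF sv(2)[OF that]] frame] sv(2)[OF that]
      by (simp add: algebra_simps)
    with sv(1) show ?thesis by blast
  qed

  \<comment> \<open>The crude choice \<open>f = 0\<close>, \<open>c = N\<close> suffices, as only
    the length is taken from \<open>wide\<close>.\<close>
  have len: "length xs = r"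
    using tall wide[of 0 N] m unfolding rank by (cases "N \<le> m") auto

  have part1: "real N / (real m * (1 + 2 * \<epsilon> + \<epsilon>\<^sup>2)) \<le> (\<Sum>i = 1..r. 1 / \<sigma> i) \<and>
      (\<Sum>i = 1..r. 1 / \<sigma> i) \<le> real N / (real m * (1 - 2 * \<epsilon> - \<epsilon>\<^sup>2))"
    if le: "N \<le> m" and T1: "T < 1 / ((sqrt 2 + 1) * pi * real N powr (3/2))"
  proof -
    have "0 < (sqrt 2 + 1) * pi * real N powr (3/2)"
      using N by (intro mult_pos_pos add_pos_pos) auto
    then have "T * ((sqrt 2 + 1) * pi * real N powr (3/2)) < 1"
      using T1 by (simp add: pos_less_divide_eq)
    then have "(sqrt 2 + 1) * \<epsilon> < 1"
      by (simp add: \<epsilon>_def mult_ac)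
    \<comment> \<open>Rationalizing gives \<epsilon> < sqrt 2 - 1, the positive root of 1 - 2
      \<epsilon> - \<epsilon>^2.\<close>
    then have "(sqrt 2 - 1) * ((sqrt 2 + 1) * \<epsilon>) < (sqrt 2 - 1) * 1"
      by (intro mult_strict_left_mono) auto
    moreover have "(sqrt 2 - 1) * ((sqrt 2 + 1) * \<epsilon>) = \<epsilon>"
      by (simp add: algebra_simps)
    ultimately have "1 + \<epsilon> < sqrt 2" by simp
    then have "(1 + \<epsilon>)\<^sup>2 < (sqrt 2)\<^sup>2"
      using \<epsilon> by (intro power_strict_mono) auto
    then have "0 < 1 - 2 * \<epsilon> - \<epsilon>\<^sup>2"
      by (simp add: power2_sum)
    then have "0 < real m * (1 - 2 * \<epsilon> - \<epsilon>\<^sup>2)" using m by simp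
    from sum_inverse_nth_bounds[OF conjunct2[OF tall[OF le]] this] show ?thesis
      unfolding \<sigma>xs len[symmetric] using tall[OF le] by simp
  qed

  have part2: "1 / (of_int \<lceil>real N / real m\<rceil> + 2 * (sqrt (of_int \<lceil>real N / real m\<rceil>) * \<epsilon>) + \<epsilon>\<^sup>2)
        \<le> (\<Sum>i = 1..r. 1 / \<sigma> i) \<and>
      (\<Sum>i = 1..r. 1 / \<sigma> i)
        \<le> 1 / (of_int \<lfloor>real N / real m\<rfloor> - 2 * (sqrt (of_int \<lceil>real N / real m\<rceil>) * \<epsilon>) - \<epsilon>\<^sup>2)"
    if lt: "m < N"
      and T2: "T < (sqrt (2 * real N) - sqrt (real N + real m)) / (pi * sqrt (real m) * real N powr (3/2))"
  proof -
    define f c where "f = nat \<lfloor>real N / real m\<rfloor>" and "c = nat \<lceil>real N / real m\<rceil>"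
    have fr: "real f = of_int \<lfloor>real N / real m\<rfloor>" and cr: "real c = of_int \<lceil>real N / real m\<rceil>"
      by (simp_all add: f_def c_def)
    have f1: "real f \<le> real N / real m" "real N / real m < real f + 1"
      and c1: "real N / real m \<le> real c" "real c < real N / real m + 1"
      unfolding fr cr by linarith+
    have "real f * real m \<le> real N" "real N \<le> real c * real m"
      using f1(1) c1(1) m by (simp_all add: field_simps)
    then have fm: "f * m \<le> N" and cm: "N \<le> c * m"
      by (simp_all flip: of_nat_mult)
    have "0 < pi * sqrt (real m) * real N powr (3/2)"
      using m N by simp
    then have "T * (pi * sqrt (real m) * real N powr (3/2)) < sqrt (2 * real N) - sqrt (real N + real m)"
      using T2 by (simp add: pos_less_divide_eq)
    then have "sqrt (real N + real m) + sqrt (real m) * \<epsilon> < sqrt (2 * real N)"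
      by (simp add: \<epsilon>_def mult_ac)
    then have "(sqrt (real N + real m) + sqrt (real m) * \<epsilon>)\<^sup>2 < (sqrt (2 * real N))\<^sup>2"
      using \<epsilon> by (intro power_strict_mono) auto
    \<comment> \<open>Squared hypothesis on \<open>T\<close>. Positivity of the lower bound follows
      from c m \<le> N + m and N - m < f m, the rounding errors of ceiling and floor.\<close>
    then have main: "2 * (sqrt (real N + real m) * sqrt (real m) * \<epsilon>) + real m * \<epsilon>\<^sup>2 < real N - real m"
      by (simp add: power2_sum power_mult_distrib)
    have "sqrt (real c) * real m \<le> sqrt (real N + real m) * sqrt (real m)"
    proof -
      have "real c * real m \<le> real N + real m"
        using c1(2) m by (simp add: field_simps)
      then have "sqrt (real c * real m) \<le> sqrt (real N + real m)" by simp
      then have "sqrt (real c * real m) * sqrt (real m) \<le> sqrt (real N + real m) * sqrt (real m)"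
        by (intro mult_right_mono) auto
      then show ?thesis by (simp add: real_sqrt_mult mult.assoc)
    qed
    then have "sqrt (real c) * real m * \<epsilon> \<le> sqrt (real N + real m) * sqrt (real m) * \<epsilon>"
      using \<epsilon> by (rule mult_right_mono)
    moreover have "real N < real m * real f + real m"
      using f1(2) m by (simp add: field_simps)
    ultimately have "0 < real m * real f - 2 * (sqrt (real c) * real m * \<epsilon>) - real m * \<epsilon>\<^sup>2"
      using main by linarith
    then have L: "0 < real m * (real f - 2 * (sqrt (real c) * \<epsilon>) - \<epsilon>\<^sup>2)"
      by (simp add: algebra_simps)
    note w = wide[OF less_imp_le[OF lt] fm cm]
    \<comment> \<open>There are \<open>m\<close> summands, and this count cancels the factor
      \<open>m\<close> in the eigenvalue bounds.\<close>
    from sum_inverse_nth_bounds[OF conjunct2[OF w] L] show ?thesis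
      unfolding \<sigma>xs len[symmetric] fr[symmetric] cr[symmetric] using conjunct1[OF w] m by simp
  qed
  show ?thesis
    using mono rank len part1 part2 unfolding t xs_def H_def \<epsilon>2 twice by simp
qed

end
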